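(* Let $G$ be a 3-uniform hypergraph with $m\ge 211$ edges. Then there exists a partition of its vertex set into three parts such that each part meets at least $\frac{3}{5}m$ edges.
   Context: A 3-uniform hypergraph has a finite vertex set and edges that are distinct 3-element subsets of it. A set meets an edge if it has nonempty intersection with it. *)

theory Defs
  imports Complex_Main "HOL-Library.Disjoint_Sets"
begin

definition three_uniform_hypergraph :: "'a set \<Rightarrow> 'a set set \<Rightarrow> bool" where
  "three_uniform_hypergraph V E \<longleftrightarrow> finite V \<and> (\<forall>e\<in>E. e \<subseteq> V \<and> card e = 3)"

definition meets :: "'a set \<Rightarrow> 'a set \<Rightarrow> bool" where
  "meets X e \<longleftrightarrow> X \<inter> e \<noteq> {}"

end

theory Submission
  imports Defs
begin

text \<open>
  Choose a tripartition \<open>A, B, C\<close> maximising the sum of the numbers of edges met by the parts, and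
  suppose that \<open>A\<close> meets fewer than \<open>3m/5\<close> edges. Let \<open>W\<close> be the set of edges missing \<open>A\<close> and let
  \<open>\<delta> = |W| - 2m/5\<close>; one has to move sets \<open>X \<subseteq> B\<close> and \<open>Y \<subseteq> C\<close> to \<open>A\<close> that meet \<open>\<delta>\<close> edges of \<open>W\<close>
  without spoiling \<open>B\<close> or \<open>C\<close>. Since no single vertex improves the sum when moved to \<open>A\<close>, \<open>B\<close> can
  afford to lose \<open>X\<close> as soon as a cost of \<open>X\<close> is within a budget of \<open>B\<close>, where both numbers depend
  only on \<open>W\<close>; the two budgets add up to \<open>4|W| - 6m/5\<close> and each is at least \<open>4\<delta>\<close>.

  Call a vertex light if its degree in \<open>W\<close> is less than \<open>\<delta>\<close>. If the light vertices of \<open>B\<close> meet \<open>\<delta>\<close>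
  edges of \<open>W\<close>, then a minimal set of light vertices doing so is affordable; otherwise all of them
  together are. So if no move works, then the light vertices meet fewer than \<open>\<delta>\<close> edges of \<open>W\<close>, and
  the degree of each heavy vertex exceeds the budget of its part. Nine heavy vertices span at most
  \<open>84 \<le> 2m/5\<close> edges, so there are at least ten, and then the budgets contradict the degree sum of \<open>W\<close>.
\<close>

section \<open>Coverage, cost and budget on a set of edges\<close>

definition cov :: "'a set set \<Rightarrow> 'a set \<Rightarrow> real" where
  "cov E X = real (card {e \<in> E. meets X e})"

definition num :: "'a set set \<Rightarrow> 'a set \<Rightarrow> nat \<Rightarrow> real" where
  "num W B k = real (card {e \<in> W. card (e \<inter> B) = k})"

text \<open>An edge of \<open>W\<close> with two or three vertices in \<open>B\<close> is lost to \<open>B\<close> only when all of them move,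
  a loss not seen by the individual vertices; hence the second term of the cost.\<close>

definition cost :: "'a set set \<Rightarrow> 'a set \<Rightarrow> 'a set \<Rightarrow> real" where
  "cost W B X = (\<Sum>v\<in>X. cov W {v}) + real (card {e \<in> W. 2 \<le> card (e \<inter> B) \<and> e \<inter> B \<subseteq> X})"

text \<open>With \<open>M\<close> edges in all, local optimality yields that \<open>B - X\<close>
  still meets at least 3M/5 + budget - cost edges. An edge of \<open>W\<close> with k vertices in
  \<open>B\<close> has weight 1 + k, lowered to 1 for k = 1: one for meeting \<open>B\<close>, k for
  its share of the degree sum over \<open>B\<close>, less one if it meets \<open>B\<close> in a
  single vertex.\<close>

definition budget :: "'a set set \<Rightarrow> 'a set \<Rightarrow> real \<Rightarrow> real" where
  "budget W B M = num W B 1 + 3 * num W B 2 + 4 * num W B 3 - 3 / 5 * M"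

lemma card_filter_sum: "finite E \<Longrightarrow> real (card {e \<in> E. P e}) = (\<Sum>e\<in>E. of_bool (P e))"
  by (simp add: Int_def)

lemma cov_sum: "finite E \<Longrightarrow> cov E X = (\<Sum>e\<in>E. of_bool (e \<inter> X \<noteq> {}))"
  unfolding cov_def meets_def by (subst card_filter_sum) (auto simp: Int_commute)

lemma num_sum: "finite E \<Longrightarrow> num E B k = (\<Sum>e\<in>E. of_bool (card (e \<inter> B) = k))"
  unfolding num_def by (rule card_filter_sum)

lemma sum_cov_singleton:
  assumes "finite W" "finite X"
  shows "(\<Sum>v\<in>X. cov W {v}) = (\<Sum>e\<in>W. real (card (e \<inter> X)))"
proof -
  have "(\<Sum>v\<in>X. cov W {v}) = (\<Sum>v\<in>X. \<Sum>e\<in>W. of_bool (v \<in> e))"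
    using assms by (intro sum.cong) (auto simp: cov_sum)
  also have "\<dots> = (\<Sum>e\<in>W. \<Sum>v\<in>X. of_bool (v \<in> e))"
    by (rule sum.swap)
  also have "\<dots> = (\<Sum>e\<in>W. real (card (e \<inter> X)))"
    using assms(2) by (intro sum.cong) (auto simp: Int_def conj_commute)
  finally show ?thesis .
qed

lemma cost_sum:
  assumes "finite W" "finite X"
  shows "cost W B X =
    (\<Sum>e\<in>W. real (card (e \<inter> X)) + of_bool (2 \<le> card (e \<inter> B) \<and> e \<inter> B \<subseteq> X))"
  unfolding cost_def sum.distrib using assms
  by (simp only: sum_cov_singleton card_filter_sum)

text \<open>Edge by edge: an edge hit by \<open>X\<close> adds at most 3 to the cost, extra unit
  included, unless all its three vertices lie in \<open>X\<close>; then it adds 4.\<close>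

lemma cost_le_cov:
  assumes W: "finite W" "\<forall>e\<in>W. card e = 3" and X: "finite X" "X \<subseteq> B"
  shows "cost W B X \<le> 3 * cov W X + num W B 3"
proof -
  have "real (card (e \<inter> X)) + of_bool (2 \<le> card (e \<inter> B) \<and> e \<inter> B \<subseteq> X)
      \<le> 3 * of_bool (e \<inter> X \<noteq> {}) + of_bool (card (e \<inter> B) = 3)" if "e \<in> W" for e
  proof -
    have e: "finite e" "card e = 3"
      using bspec[OF W(2) that] by (auto intro: card_ge_0_finite)
    have le: "card (e \<inter> X) \<le> card (e \<inter> B)" "card (e \<inter> B) \<le> 3"
      using e X(2) by (auto intro!: card_mono simp flip: e(2))
    have z: "e \<inter> X = {} \<longleftrightarrow> card (e \<inter> X) = 0" using e by auto
    have eq: "e \<inter> B \<subseteq> X \<Longrightarrow> card (e \<inter> B) = card (e \<inter> X)"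
      using X(2) by (intro arg_cong[where f = card]) auto
    show ?thesis unfolding z using le eq by (auto simp: of_bool_def)
  qed
  then show ?thesis
    using W(1) X(1) by (simp only: cost_sum cov_sum num_sum sum_distrib_left sum.distrib[symmetric])
      (rule sum_mono, simp)
qed

text \<open>Meant for a minimal \<open>X\<close>, where deleting any vertex makes the coverage
  small. An edge with one vertex in \<open>X\<close> survives at least one of the two deletions; an
  edge with more survives both and yields 4 on the right, one short only if it lies inside
  \<open>X\<close>.\<close>

lemma cost_le_two:
  assumes W: "finite W" "\<forall>e\<in>W. card e = 3" and X: "finite X" "X \<subseteq> B"
    and vw: "v \<in> X" "w \<in> X" "v \<noteq> w"
  shows "cost W B X + cov W X \<le> 2 * cov W (X - {v}) + 2 * cov W (X - {w}) + num W B 3"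
proof -
  have "real (card (e \<inter> X)) + of_bool (2 \<le> card (e \<inter> B) \<and> e \<inter> B \<subseteq> X) + of_bool (e \<inter> X \<noteq> {})
      \<le> 2 * of_bool (e \<inter> (X - {v}) \<noteq> {}) + 2 * of_bool (e \<inter> (X - {w}) \<noteq> {})
        + of_bool (card (e \<inter> B) = 3)" if "e \<in> W" for e
  proof -
    have e: "finite e" "card e = 3"
      using bspec[OF W(2) that] by (auto intro: card_ge_0_finite)
    have le: "card (e \<inter> X) \<le> card (e \<inter> B)" "card (e \<inter> B) \<le> 3"
      using e X(2) by (auto intro!: card_mono simp flip: e(2))
    have eq: "e \<inter> B \<subseteq> X \<Longrightarrow> card (e \<inter> B) = card (e \<inter> X)"
      using X(2) by (intro arg_cong[where f = card]) auto
    consider "e \<inter> X = {}" | "card (e \<inter> X) = 1" | "card (e \<inter> X) \<ge> 2"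
      using e by (metis One_nat_def Suc_1 Suc_leI card_gt_0_iff finite_Int le_neq_implies_less)
    then show ?thesis
    proof cases
      case 1
      with eq show ?thesis by auto
    next
      case 2
      then obtain u where u: "e \<inter> X = {u}" by (auto simp: card_1_singleton_iff)
      have "e \<inter> (X - {v}) \<noteq> {} \<or> e \<inter> (X - {w}) \<noteq> {}" using u vw(3) by blast
      moreover have "\<not> (2 \<le> card (e \<inter> B) \<and> e \<inter> B \<subseteq> X)" using eq 2 by auto
      ultimately show ?thesis using 2 u by (auto simp: of_bool_def)
    next
      case 3
      have ne: "e \<inter> (X - {y}) \<noteq> {}" for y
      proof
        assume "e \<inter> (X - {y}) = {}"
        then have "e \<inter> X \<subseteq> {y}" by auto
        then have "card (e \<inter> X) \<le> card {y}" by (intro card_mono) auto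
        with 3 show False by simp
      qed
      show ?thesis using ne[of v] ne[of w] le eq by (auto simp: of_bool_def)
    qed
  qed
  then show ?thesis
    using W(1) X(1) by (simp only: cost_sum cov_sum num_sum sum_distrib_left sum.distrib[symmetric])
      (rule sum_mono, simp)
qed

section \<open>Light and heavy vertices of one part\<close>

lemma cost_singleton:
  shows "cost W B {v} = cov W {v}"
proof -
  have "\<not> e \<inter> B \<subseteq> {v}" if "2 \<le> card (e \<inter> B)" for e
    using card_mono[of "{v}" "e \<inter> B"] that by auto
  then have "{e \<in> W. 2 \<le> card (e \<inter> B) \<and> e \<inter> B \<subseteq> {v}} = {}" by blast
  then show ?thesis by (simp add: cost_def del: Collect_empty_eq)
qed

text \<open>A minimal set of light vertices covering \<open>\<delta>\<close> edges has at least two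
  vertices, so \<open>cost_le_two\<close> prices it below \<open>4 * \<delta> + num W B 3\<close>.
  Once \<open>T\<close> is known to cover less than \<open>\<delta>\<close>,
  \<open>cost_le_cov\<close> makes it affordable. A heavy vertex covers \<open>\<delta>\<close>
  edges alone, so its degree, which is its cost, must exceed \<open>D\<close>.\<close>

lemma light_heavy:
  assumes W: "finite W" "\<forall>e\<in>W. card e = 3" and B: "finite B"
    and \<delta>: "\<delta> > 0" and D: "4 * \<delta> + num W B 3 \<le> D"
    and stuck: "\<forall>X\<subseteq>B. cost W B X \<le> D \<longrightarrow> cov W X < \<delta>"
    and T: "T = {v \<in> B. cov W {v} < \<delta>}"
  shows "cov W T < \<delta>" "cost W B T \<le> D" "\<forall>v\<in>B - T. D < cov W {v}"
proof -
  show small: "cov W T < \<delta>"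
  proof (rule ccontr)
    assume "\<not> ?thesis"
    then have "finite T \<and> T \<subseteq> B \<and> \<delta> \<le> cov W T" using B T by auto
    then obtain X where X: "X \<subseteq> T" "\<delta> \<le> cov W X"
      and min: "\<And>Y. Y \<subseteq> T \<Longrightarrow> \<delta> \<le> cov W Y \<Longrightarrow> card X \<le> card Y"
      using ex_has_least_nat[of "\<lambda>Y. Y \<subseteq> T \<and> \<delta> \<le> cov W Y" T card] by auto
    have fX: "finite X" "X \<subseteq> B" using X(1) B T by (auto intro: finite_subset)
    have drop: "cov W (X - {v}) < \<delta>" if "v \<in> X" for v
      using min[of "X - {v}"] X(1) fX(1) that card_Diff1_less[of X v] by force
    have "X \<noteq> {}" using X(2) \<delta> by (auto simp: cov_def meets_def)
    then obtain v where v: "v \<in> X" by auto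
    have "X \<noteq> {v}" using X T by auto
    then obtain w where w: "w \<in> X" "v \<noteq> w" using v by auto
    have "cost W B X \<le> D"
      using cost_le_two[OF W fX v w] drop[OF v] drop[OF w(1)] X(2) D \<delta> by linarith
    with stuck fX(2) have "cov W X < \<delta>" by blast
    with X(2) show False by simp
  qed
  have "finite T" "T \<subseteq> B" using B T by auto
  then show "cost W B T \<le> D" using cost_le_cov[OF W, of T B] small \<delta> D by simp
  show "\<forall>v\<in>B - T. D < cov W {v}"
    using stuck cost_singleton[of W B] T by (auto simp: not_less[symmetric])
qed

text \<open>Here \<open>w0\<close> to \<open>w3\<close> count the edges of \<open>W\<close> by their
  number of vertices in \<open>B\<close>, and \<open>k\<close>, \<open>l\<close> count the heavy
  vertices of \<open>B\<close> and \<open>C\<close>; each product is a number of heavy vertices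
  times a budget, bounded by a degree sum.\<close>

lemma budget_arith:
  fixes w0 w1 w2 w3 M \<delta> t :: real and k l :: nat
  assumes "w0 \<ge> 0" "w1 \<ge> 0" "w2 \<ge> 0" "w3 \<ge> 0" "\<delta> > 0"
    and x: "w0 + w1 + w2 + w3 = 2 / 5 * M + \<delta>"
    and kl: "k \<le> 2" "k + l \<ge> 10" "M > 0"
    and E: "w2 + 3 * w1 + 4 * w0 - 3 / 5 * M \<ge> 0"
    and k: "real k * (w1 + 3 * w2 + 4 * w3 - 3 / 5 * M) \<le> w1 + 2 * w2 + 3 * w3"
    and l: "real l * (w2 + 3 * w1 + 4 * w0 - 3 / 5 * M) \<le> w2 + 2 * w1 + 3 * w0"
    and w3: "w3 < \<delta>" and w23: "k \<le> 1 \<Longrightarrow> w2 + w3 < \<delta>"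
  shows False
proof -
  have "8 * (w2 + 3 * w1 + 4 * w0 - 3 / 5 * M) \<le> real l * (w2 + 3 * w1 + 4 * w0 - 3 / 5 * M)"
    using E kl by (intro mult_right_mono) auto
  with l have 8: "8 * (w2 + 3 * w1 + 4 * w0 - 3 / 5 * M) \<le> w2 + 2 * w1 + 3 * w0" by linarith
  show False
  proof (cases "k \<le> 1")
    case True
    \<comment> \<open>By \<open>8\<close>, 7 w2 + 22 w1 + 29 w0 is at most 24M/5, whereas w0 + w1
      exceeds 2M/5.\<close>
    show ?thesis using 8 w23[OF True] assms(1-6) kl(3) by argo
  next
    case False
    then have "k = 2" using kl by simp
    with k have "2 * (w1 + 3 * w2 + 4 * w3 - 3 / 5 * M) \<le> w1 + 2 * w2 + 3 * w3" by simp
    \<comment> \<open>Five times w1 + 4 w2 + 5 w3 \<le> 6M/5, added to the inequality from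
      \<open>8\<close>, gives 27 (w0 + w1 + w2) \<le> 54M/5, but w0 + w1 + w2 exceeds 2M/5.\<close>
    then show ?thesis using 8 assms(1-6) w3 kl by argo
  qed
qed

text \<open>The heavy degrees are part of the degree sum over \<open>B\<close>, in which an edge
  counts once per vertex in \<open>B\<close>. An edge with more vertices in \<open>B\<close> than
  there are heavy ones contains a light vertex, so \<open>cov W T\<close> counts it.\<close>

lemma heavy_count:
  assumes W: "finite W" "\<forall>e\<in>W. card e = 3" and B: "finite B"
    and T: "T \<subseteq> B" "cov W T < \<delta>" and heavy: "\<forall>v\<in>B - T. D < cov W {v}"
  shows "real (card (B - T)) * D \<le> num W B 1 + 2 * num W B 2 + 3 * num W B 3"
    and "card (B - T) \<le> 2 \<Longrightarrow> num W B 3 < \<delta>"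
    and "card (B - T) \<le> 1 \<Longrightarrow> num W B 2 + num W B 3 < \<delta>"
proof -
  have le3: "card (e \<inter> B) \<le> 3" if "e \<in> W" for e
  proof -
    have "finite e" using bspec[OF W(2) that] by (auto intro: card_ge_0_finite)
    then show ?thesis using bspec[OF W(2) that] by (auto intro!: card_mono simp flip: bspec[OF W(2) that])
  qed
  have "real (card (B - T)) * D \<le> (\<Sum>v\<in>B - T. cov W {v})"
    using sum_mono[of "B - T" "\<lambda>_. D" "\<lambda>v. cov W {v}"] heavy by force
  also have "\<dots> \<le> (\<Sum>v\<in>B. cov W {v})"
    using B by (intro sum_mono2) (auto simp: cov_def)
  also have "\<dots> = (\<Sum>e\<in>W. real (card (e \<inter> B)))"
    by (rule sum_cov_singleton[OF W(1) B])
  also have "\<dots> = (\<Sum>e\<in>W. of_bool (card (e \<inter> B) = 1) + 2 * of_bool (card (e \<inter> B) = 2)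
      + 3 * of_bool (card (e \<inter> B) = 3))"
    by (intro sum.cong refl) (use le3 in \<open>force simp: of_bool_def le_Suc_eq numeral_3_eq_3\<close>)
  also have "\<dots> = num W B 1 + 2 * num W B 2 + 3 * num W B 3"
    using W(1) by (simp only: num_sum sum.distrib sum_distrib_left)
  finally show "real (card (B - T)) * D \<le> num W B 1 + 2 * num W B 2 + 3 * num W B 3" .
  have hit: "e \<inter> T \<noteq> {}" if "card (B - T) < card (e \<inter> B)" for e
  proof
    assume "e \<inter> T = {}"
    then have "card (e \<inter> B) \<le> card (B - T)" using B by (intro card_mono) auto
    with that show False by simp
  qed
  show "num W B 3 < \<delta>" if "card (B - T) \<le> 2"
  proof -
    have "num W B 3 \<le> cov W T"
      unfolding num_sum[OF W(1)] cov_sum[OF W(1)] using that hit by (intro sum_mono) auto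
    with T(2) show ?thesis by simp
  qed
  show "num W B 2 + num W B 3 < \<delta>" if "card (B - T) \<le> 1"
  proof -
    have "num W B 2 + num W B 3 \<le> cov W T"
      unfolding num_sum[OF W(1)] cov_sum[OF W(1)] sum.distrib[symmetric]
      using that hit by (intro sum_mono) auto
    with T(2) show ?thesis by simp
  qed
qed

section \<open>Existence of an affordable transfer\<close>

lemma exists_transfer:
  assumes W: "finite W" "\<forall>e\<in>W. card e = 3 \<and> e \<subseteq> B \<union> C"
    and BC: "finite B" "finite C" "B \<inter> C = {}"
    and M: "M \<ge> 210" "real (card W) > 2 / 5 * M"
    and b: "budget W B M + num W B 0 \<le> 2 / 5 * M"
    and c: "budget W C M + num W C 0 \<le> 2 / 5 * M"
  shows "\<exists>X Y. X \<subseteq> B \<and> Y \<subseteq> C \<and> cost W B X \<le> budget W B M \<and> cost W C Y \<le> budget W C M \<and>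
    cov W (X \<union> Y) \<ge> real (card W) - 2 / 5 * M"
proof (rule ccontr)
  assume none: "\<not> ?thesis"
  define \<delta> where "\<delta> = real (card W) - 2 / 5 * M"
  have \<delta>: "\<delta> > 0" using M by (simp add: \<delta>_def)
  have W3: "\<forall>e\<in>W. card e = 3" using W(2) by blast
  have split: "card (e \<inter> B) + card (e \<inter> C) = 3" if "e \<in> W" for e
  proof -
    have "e = (e \<inter> B) \<union> (e \<inter> C)" using bspec[OF W(2) that] by auto
    moreover have "card ((e \<inter> B) \<union> (e \<inter> C)) = card (e \<inter> B) + card (e \<inter> C)"
      using BC by (intro card_Un_disjoint) auto
    ultimately show ?thesis using bspec[OF W3 that] by simp
  qed
  have swap: "num W C j = num W B (3 - j)" if "j \<le> 3" for j
    unfolding num_def using split that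
    by (intro arg_cong[where f = "\<lambda>S. real (card S)"] Collect_cong) fastforce
  have numC: "num W C 0 = num W B 3" "num W C 1 = num W B 2" "num W C 2 = num W B 1"
    "num W C 3 = num W B 0"
    by (simp_all add: swap)
  have "real (card W) = (\<Sum>e\<in>W. of_bool (card (e \<inter> B) = 0) + of_bool (card (e \<inter> B) = 1)
      + of_bool (card (e \<inter> B) = 2) + of_bool (card (e \<inter> B) = 3))"
  proof (subst real_of_card, intro sum.cong refl)
    fix e assume "e \<in> W"
    with split have "card (e \<inter> B) \<in> {0, 1, 2, 3}" by force
    then show "1 = of_bool (card (e \<inter> B) = 0) + of_bool (card (e \<inter> B) = 1)
      + of_bool (card (e \<inter> B) = 2) + (of_bool (card (e \<inter> B) = 3) :: real)" by auto
  qed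
  then have total: "num W B 0 + num W B 1 + num W B 2 + num W B 3 = 2 / 5 * M + \<delta>"
    unfolding \<delta>_def using W(1) by (simp only: num_sum sum.distrib)
  have emp: "cost W U {} = 0" for U
  proof -
    have "{e \<in> W. 2 \<le> card (e \<inter> U) \<and> e \<inter> U \<subseteq> {}} = {}" by force
    then show ?thesis by (simp add: cost_def del: Collect_empty_eq subset_empty)
  qed
  \<comment> \<open>The budgets add up to 2M/5 + 4\<delta>, so the upper bound on either one is a
    lower bound on the other.\<close>
  have DB: "4 * \<delta> + num W B 3 \<le> budget W B M" and DC: "4 * \<delta> + num W C 3 \<le> budget W C M"
    using b c total unfolding budget_def numC by argo+
  define S where "S = {v \<in> B. cov W {v} < \<delta>}"
  define T where "T = {v \<in> C. cov W {v} < \<delta>}"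
  have ge0: "0 \<le> num W B j" for j by (simp add: num_def)
  have less: "cov W (X \<union> Y) < \<delta>"
    if "X \<subseteq> B" "Y \<subseteq> C" "cost W B X \<le> budget W B M" "cost W C Y \<le> budget W C M" for X Y
    using none that unfolding \<delta>_def by (meson not_le_imp_less)
  have pos: "0 \<le> budget W B M" "0 \<le> budget W C M"
    using DB DC \<delta> ge0[of 0] ge0[of 3] unfolding numC by linarith+
  have stuckB: "\<forall>X\<subseteq>B. cost W B X \<le> budget W B M \<longrightarrow> cov W X < \<delta>"
    using less[of _ "{}"] pos emp by simp
  have stuckC: "\<forall>X\<subseteq>C. cost W C X \<le> budget W C M \<longrightarrow> cov W X < \<delta>"
    using less[of "{}"] pos emp by simp
  note lhB = light_heavy[OF W(1) W3 BC(1) \<delta> DB stuckB S_def]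
  note lhC = light_heavy[OF W(1) W3 BC(2) \<delta> DC stuckC T_def]
  have sub: "S \<subseteq> B" "T \<subseteq> C" by (auto simp: S_def T_def)
  note hB = heavy_count[OF W(1) W3 BC(1) sub(1) lhB(1,3)]
  note hC = heavy_count[OF W(1) W3 BC(2) sub(2) lhC(1,3)]
  have ST: "cov W (S \<union> T) < \<delta>"
    by (rule less[OF sub lhB(2) lhC(2)])
  define k where "k = card (B - S)"
  define l where "l = card (C - T)"
  have kl: "k + l \<ge> 10"
  proof (rule ccontr)
    assume "\<not> ?thesis"
    define H where "H = (B - S) \<union> (C - T)"
    have H: "finite H" "card H = k + l"
      using BC by (auto simp: H_def k_def l_def intro!: card_Un_disjoint)
    have "W \<subseteq> {e \<in> W. meets (S \<union> T) e} \<union> {e. e \<subseteq> H \<and> card e = 3}"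
      using W(2) by (auto simp: meets_def H_def)
    then have "card W \<le> card ({e \<in> W. meets (S \<union> T) e} \<union> {e. e \<subseteq> H \<and> card e = 3})"
      using W(1) H(1) by (intro card_mono) auto
    also have "\<dots> \<le> card {e \<in> W. meets (S \<union> T) e} + card {e. e \<subseteq> H \<and> card e = 3}"
      by (rule card_Un_le)
    also have "card {e. e \<subseteq> H \<and> card e = 3} = (k + l) choose 3"
      using n_subsets[OF H(1)] H(2) by simp
    also have "\<dots> \<le> 9 choose 3"
      using \<open>\<not> k + l \<ge> 10\<close> by (intro binomial_right_mono) auto
    \<comment> \<open>This is 2/5 of 210, the lower bound on \<open>M\<close>.\<close>
    also have "\<dots> = 84" by (simp add: eval_nat_numeral)
    finally have "real (card W) \<le> cov W (S \<union> T) + 84"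
      unfolding cov_def by linarith
    then show False using ST M by (simp add: \<delta>_def)
  qed
  note kB = hB[folded k_def, unfolded budget_def] and lC = hC[folded l_def, unfolded budget_def numC]
  \<comment> \<open>Otherwise three times the sum of the budgets, 12|W| - 18M/5, is at most the
    total degree sum 3|W|, so |W| \<le> 2M/5.\<close>
  have "k \<le> 2 \<or> l \<le> 2"
  proof (rule ccontr)
    assume "\<not> ?thesis"
    then have "3 * budget W B M \<le> real k * budget W B M" "3 * budget W C M \<le> real l * budget W C M"
      using pos by (auto intro!: mult_right_mono)
    then show False
      using kB(1) lC(1) total \<delta> unfolding budget_def numC by argo
  qed
  then show False
  proof
    assume k: "k \<le> 2"
    show False
      using budget_arith[OF ge0 ge0 ge0 ge0 \<delta> total k kl _ _ kB(1) lC(1) kB(2)[OF k] kB(3)]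
        M(1) pos(2) unfolding budget_def numC by simp
  next
    assume l: "l \<le> 2"
    have total': "num W B 3 + num W B 2 + num W B 1 + num W B 0 = 2 / 5 * M + \<delta>"
      and lk: "l + k \<ge> 10" using total kl by simp_all
    show False
      using budget_arith[OF ge0 ge0 ge0 ge0 \<delta> total' l lk _ _ lC(1) kB(1) lC(2)[OF l] lC(3)]
        M(1) pos(1) unfolding budget_def numC by simp
  qed
qed

section \<open>Optimal tripartitions\<close>

definition tripartition :: "'a set \<Rightarrow> 'a set \<Rightarrow> 'a set \<Rightarrow> 'a set \<Rightarrow> bool" where
  "tripartition V A B C \<longleftrightarrow> A \<union> B \<union> C = V \<and> A \<inter> B = {} \<and> A \<inter> C = {} \<and> B \<inter> C = {}"

definition optimal :: "'a set \<Rightarrow> 'a set set \<Rightarrow> 'a set \<Rightarrow> 'a set \<Rightarrow> 'a set \<Rightarrow> bool" where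
  "optimal V E A B C \<longleftrightarrow> tripartition V A B C \<and>
    (\<forall>A' B' C'. tripartition V A' B' C' \<longrightarrow> cov E A' + cov E B' + cov E C' \<le> cov E A + cov E B + cov E C)"

lemma optimal_exists:
  assumes "finite V"
  shows "\<exists>A B C. optimal V E A B C"
proof -
  let ?P = "{(A, B, C). tripartition V A B C}"
  let ?f = "\<lambda>(A, B, C). cov E A + cov E B + cov E C"
  have "?P \<subseteq> Pow V \<times> Pow V \<times> Pow V" by (auto simp: tripartition_def)
  then have fin: "finite (?f ` ?P)" using assms by (meson finite_Pow_iff finite_SigmaI finite_imageI finite_subset)
  moreover have "(V, {}, {}) \<in> ?P" by (auto simp: tripartition_def)
  ultimately have "Max (?f ` ?P) \<in> ?f ` ?P" by (intro Max_in) auto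
  then obtain A B C where "tripartition V A B C" "cov E A + cov E B + cov E C = Max (?f ` ?P)"
    by auto
  moreover have "cov E A' + cov E B' + cov E C' \<le> Max (?f ` ?P)" if "tripartition V A' B' C'" for A' B' C'
    using that by (intro Max_ge[OF fin]) (force simp: image_iff)
  ultimately show ?thesis unfolding optimal_def by metis
qed

text \<open>These transpositions bring any deficient part to the first place.\<close>

lemma optimal_swap:
  "optimal V E A B C \<Longrightarrow> optimal V E A C B" "optimal V E A B C \<Longrightarrow> optimal V E B A C"
  unfolding optimal_def tripartition_def by (auto simp: Int_commute Un_ac add_ac)

lemma optimal_move:
  assumes "optimal V E A B C" "v \<in> B"
  shows "cov E (insert v A) + cov E (B - {v}) \<le> cov E A + cov E B"
proof -
  have "tripartition V (insert v A) (B - {v}) C"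
    using assms unfolding optimal_def tripartition_def by auto
  with assms show ?thesis unfolding optimal_def by force
qed

section \<open>Effect of a transfer on the parts\<close>

lemma sum_filter_of_bool:
  "finite E \<Longrightarrow> (\<Sum>e | e \<in> E \<and> P e. f e) = (\<Sum>e\<in>E. of_bool (P e) * (f e :: real))"
proof -
  assume "finite E"
  then have "(\<Sum>e | e \<in> E \<and> P e. f e) = (\<Sum>e\<in>E. if P e then f e else 0)"
    by (rule sum.inter_filter)
  also have "\<dots> = (\<Sum>e\<in>E. of_bool (P e) * f e)"
    by (intro sum.cong) auto
  finally show ?thesis .
qed

lemma cov_Un:
  assumes "finite E"
  shows "cov E (A \<union> Z) = cov E A + cov {e \<in> E. e \<inter> A = {}} Z"
proof -
  let ?W = "{e \<in> E. e \<inter> A = {}}"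
  have "card ({e \<in> E. meets A e} \<union> {e \<in> ?W. meets Z e}) =
      card {e \<in> E. meets A e} + card {e \<in> ?W. meets Z e}"
    using assms by (intro card_Un_disjoint) (auto simp: meets_def)
  moreover have "{e \<in> E. meets A e} \<union> {e \<in> ?W. meets Z e} = {e \<in> E. meets (A \<union> Z) e}"
    by (auto simp: meets_def)
  ultimately show ?thesis unfolding cov_def by simp
qed

text \<open>When \<open>v\<close> moves, \<open>A\<close> gains the edges at \<open>v\<close> that
  missed \<open>A\<close>, and \<open>B\<close> loses those it met in \<open>v\<close> alone;
  \<open>move\<close> says that the gain does not exceed the loss.\<close>

lemma cov_insert_le_cov_Diff:
  assumes E: "finite E"
    and move: "cov E (insert v A) + cov E (B - {v}) \<le> cov E A + cov E B"
  shows "cov {e \<in> E. e \<inter> A = {}} {v} \<le> real (card {e \<in> E. e \<inter> B = {v}})"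
proof -
  have "cov E (insert v A) = cov E A + cov {e \<in> E. e \<inter> A = {}} {v}"
    using cov_Un[OF E, of A "{v}"] by simp
  moreover have "cov E B = cov E (B - {v}) + real (card {e \<in> E. e \<inter> B = {v}})"
    unfolding cov_sum[OF E] card_filter_sum[OF E] sum.distrib[symmetric]
    by (intro sum.cong) (auto simp: of_bool_def)
  ultimately show ?thesis using move by simp
qed

text \<open>Since \<open>cov W {v} \<le> s v\<close>, where \<open>s v\<close> counts the edges meeting \<open>B\<close> in \<open>v\<close> only, the sum of
  \<open>s v - cov W {v}\<close> over \<open>X\<close> is at most its sum over \<open>B\<close>; in the number of edges still met by
  \<open>B - X\<close> the latter cancels against everything that does not come from \<open>W\<close>.\<close>

lemma transfer_bounds:
  assumes E: "finite E" "\<forall>e\<in>E. card e = 3" and B: "finite B" "A \<inter> B = {}"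
    and move: "\<forall>v\<in>B. cov E (insert v A) + cov E (B - {v}) \<le> cov E A + cov E B"
    and W: "W = {e \<in> E. e \<inter> A = {}}"
  shows "budget W B (card E) + num W B 0 \<le> 2 / 5 * card E"
    and "X \<subseteq> B \<Longrightarrow> cost W B X \<le> budget W B (card E) \<Longrightarrow> 3 / 5 * card E \<le> cov E (B - X)"
proof -
  define s where "s v = real (card {e \<in> E. e \<inter> B = {v}})" for v
  have fW: "finite W" using E W by simp
  have gs: "cov W {v} \<le> s v" if "v \<in> B" for v
    using cov_insert_le_cov_Diff[OF E(1)] move that unfolding W s_def by blast
  have sX: "(\<Sum>v\<in>X. s v) = (\<Sum>e\<in>E. of_bool (card (e \<inter> B) = 1 \<and> e \<inter> B \<subseteq> X))" if "X \<subseteq> B" for X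
  proof -
    have "(\<Sum>v\<in>X. s v) = (\<Sum>e\<in>E. \<Sum>v\<in>X. of_bool (e \<inter> B = {v}))"
      unfolding s_def card_filter_sum[OF E(1)] by (rule sum.swap)
    also have "\<dots> = (\<Sum>e\<in>E. of_bool (card (e \<inter> B) = 1 \<and> e \<inter> B \<subseteq> X))"
    proof (rule sum.cong[OF refl])
      fix e
      show "(\<Sum>v\<in>X. of_bool (e \<inter> B = {v})) = (of_bool (card (e \<inter> B) = 1 \<and> e \<inter> B \<subseteq> X) :: real)"
      proof (cases "\<exists>u. e \<inter> B = {u}")
        case True
        then obtain u where u: "e \<inter> B = {u}" by blast
        have "finite X" using that B(1) finite_subset by blast
        then show ?thesis by (simp add: u of_bool_def sum.delta)
      next
        case False
        then show ?thesis by (auto simp: card_1_singleton_iff)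
      qed
    qed
    finally show ?thesis .
  qed
  have gX: "(\<Sum>v\<in>X. cov W {v}) = (\<Sum>e\<in>E. of_bool (e \<inter> A = {}) * real (card (e \<inter> X)))" if "X \<subseteq> B" for X
    using that B(1) E(1) fW unfolding W
    by (subst sum_cov_singleton) (auto intro: finite_subset simp: sum_filter_of_bool)
  have numE: "num W B k = (\<Sum>e\<in>E. of_bool (e \<inter> A = {}) * of_bool (card (e \<inter> B) = k))" for k
    unfolding num_sum[OF fW] by (simp only: W sum_filter_of_bool[OF E(1)])
  have small: "card (e \<inter> A) + card (e \<inter> B) \<le> 3" "finite e" if "e \<in> E" for e
  proof -
    show fe: "finite e" using E(2) that by (auto intro: card_ge_0_finite)
    have "card (e \<inter> A) + card (e \<inter> B) = card (e \<inter> (A \<union> B))"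
      using fe B(2) by (subst card_Un_disjoint[symmetric]) (auto simp: Int_Un_distrib)
    also have "\<dots> \<le> card e" using fe by (intro card_mono) auto
    finally show "card (e \<inter> A) + card (e \<inter> B) \<le> 3" using E(2) that by simp
  qed
  have "0 \<le> (\<Sum>v\<in>B. s v) - (\<Sum>v\<in>B. cov W {v})"
    using sum_mono[of B "\<lambda>v. cov W {v}" s] gs by simp
  \<comment> \<open>Each edge of \<open>W\<close> contributes exactly 1 to the left side; any other
    edge contributes 1 if it meets \<open>B\<close> in one vertex and 0 otherwise.\<close>
  also have "\<dots> + num W B 0 + num W B 1 + 3 * num W B 2 + 4 * num W B 3 \<le> (\<Sum>e\<in>E. 1)"
    unfolding sX[OF subset_refl] gX[OF subset_refl] numE sum_distrib_left
      sum.distrib[symmetric] sum_subtractf[symmetric]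
  proof (rule sum_mono)
    fix e assume e: "e \<in> E"
    show "of_bool (card (e \<inter> B) = 1 \<and> e \<inter> B \<subseteq> B) - of_bool (e \<inter> A = {}) * real (card (e \<inter> B)) +
      of_bool (e \<inter> A = {}) * of_bool (card (e \<inter> B) = 0) + of_bool (e \<inter> A = {}) * of_bool (card (e \<inter> B) = 1) +
      3 * (of_bool (e \<inter> A = {}) * of_bool (card (e \<inter> B) = 2)) +
      4 * (of_bool (e \<inter> A = {}) * of_bool (card (e \<inter> B) = 3)) \<le> (1::real)"
      using small[OF e] by (auto simp: of_bool_def)
  qed
  finally show "budget W B (card E) + num W B 0 \<le> 2 / 5 * card E"
    by (simp add: budget_def)
  assume X: "X \<subseteq> B" and cost: "cost W B X \<le> budget W B (card E)"
  show "3 / 5 * card E \<le> cov E (B - X)"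
  proof -
    \<comment> \<open>An edge outside \<open>W\<close> with two vertices in \<open>B\<close> has its
      third in \<open>A\<close>. All such edges are written off as lost; the identity for
      \<open>cov E B\<close> below contains the same \<open>t\<close>, so nothing is wasted.\<close>
    define t where "t = (\<Sum>e\<in>E. of_bool (card (e \<inter> A) = 1 \<and> card (e \<inter> B) = 2) :: real)"
    define d where "d = real (card {e \<in> W. 2 \<le> card (e \<inter> B) \<and> e \<inter> B \<subseteq> X})"
    have d: "d = (\<Sum>e\<in>E. of_bool (e \<inter> A = {}) * of_bool (2 \<le> card (e \<inter> B) \<and> e \<inter> B \<subseteq> X))"
      unfolding d_def card_filter_sum[OF fW] by (simp add: W sum_filter_of_bool[OF E(1)])
    have "cov E B \<le> cov E (B - X) + (\<Sum>v\<in>X. s v) + d + t"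
      unfolding sX[OF X] d t_def cov_sum[OF E(1)] sum.distrib[symmetric]
    proof (rule sum_mono)
      fix e assume e: "e \<in> E"
      have "card (e \<inter> A) = 0 \<longleftrightarrow> e \<inter> A = {}" "card (e \<inter> B) = 0 \<longleftrightarrow> e \<inter> B = {}"
        using small(2)[OF e] by auto
      moreover have "e \<inter> (B - X) = {} \<longleftrightarrow> e \<inter> B \<subseteq> X" by auto
      ultimately show "of_bool (e \<inter> B \<noteq> {}) \<le> of_bool (e \<inter> (B - X) \<noteq> {}) +
          of_bool (card (e \<inter> B) = 1 \<and> e \<inter> B \<subseteq> X) +
          of_bool (e \<inter> A = {}) * of_bool (2 \<le> card (e \<inter> B) \<and> e \<inter> B \<subseteq> X) +
          (of_bool (card (e \<inter> A) = 1 \<and> card (e \<inter> B) = 2) :: real)"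
        using small(1)[OF e] unfolding of_bool_def by (simp split: if_split) linarith
    qed
    moreover have "num W B 1 + 3 * num W B 2 + 4 * num W B 3 + (\<Sum>v\<in>B. s v) + t =
        cov E B + (\<Sum>v\<in>B. cov W {v})"
      unfolding sX[OF subset_refl] gX[OF subset_refl] numE t_def cov_sum[OF E(1)] sum_distrib_left
        sum.distrib[symmetric]
    proof (rule sum.cong[OF refl])
      fix e assume e: "e \<in> E"
      have "card (e \<inter> A) = 0 \<longleftrightarrow> e \<inter> A = {}" "card (e \<inter> B) = 0 \<longleftrightarrow> e \<inter> B = {}"
        using small(2)[OF e] by auto
      then show "of_bool (e \<inter> A = {}) * of_bool (card (e \<inter> B) = 1) +
          3 * (of_bool (e \<inter> A = {}) * of_bool (card (e \<inter> B) = 2)) +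
          4 * (of_bool (e \<inter> A = {}) * of_bool (card (e \<inter> B) = 3)) +
          of_bool (card (e \<inter> B) = 1 \<and> e \<inter> B \<subseteq> B) +
          of_bool (card (e \<inter> A) = 1 \<and> card (e \<inter> B) = 2) =
          of_bool (e \<inter> B \<noteq> {}) + of_bool (e \<inter> A = {}) * real (card (e \<inter> B))"
        using small(1)[OF e] unfolding of_bool_def by (simp split: if_split) linarith
    qed
    moreover have "(\<Sum>v\<in>X. s v) + (\<Sum>v\<in>B. cov W {v}) \<le> (\<Sum>v\<in>B. s v) + (\<Sum>v\<in>X. cov W {v})"
    proof -
      have "(\<Sum>v\<in>B - X. cov W {v}) \<le> (\<Sum>v\<in>B - X. s v)" using gs by (intro sum_mono) auto
      then show ?thesis using sum.subset_diff[OF X B(1), of s]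
          sum.subset_diff[OF X B(1), of "\<lambda>v. cov W {v}"] by linarith
    qed
    ultimately show ?thesis
      using cost unfolding cost_def budget_def d_def[symmetric] by linarith
  qed
qed

lemma optimal_repair:
  assumes V: "finite V" and E: "finite E" "\<forall>e\<in>E. e \<subseteq> V \<and> card e = 3" "card E \<ge> 210"
    and opt: "optimal V E A B C" and low: "cov E A < 3 / 5 * card E"
  shows "\<exists>A' B' C'. tripartition V A' B' C' \<and> (\<forall>X\<in>{A', B', C'}. 3 / 5 * card E \<le> cov E X)"
proof -
  define W where "W = {e \<in> E. e \<inter> A = {}}"
  have tri: "A \<union> B \<union> C = V" "A \<inter> B = {}" "A \<inter> C = {}" "B \<inter> C = {}"
    using opt by (auto simp: optimal_def tripartition_def)
  have fin: "finite B" "finite C" "finite W" and E3: "\<forall>e\<in>E. card e = 3"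
    using V E tri(1) by (auto simp: W_def)
  have "card ({e \<in> E. meets A e} \<union> W) = card {e \<in> E. meets A e} + card W"
    using E(1) fin(3) by (intro card_Un_disjoint) (auto simp: W_def meets_def)
  moreover have "{e \<in> E. meets A e} \<union> W = E" by (auto simp: W_def meets_def)
  ultimately have "card E = card {e \<in> E. meets A e} + card W" by simp
  then have sum: "card E = cov E A + card W" by (simp add: cov_def)
  have W: "\<forall>e\<in>W. card e = 3 \<and> e \<subseteq> B \<union> C"
    using E(2) tri(1) by (auto simp: W_def)
  have big: "real (card W) > 2 / 5 * card E"
    using low sum by simp
  have mB: "\<forall>v\<in>B. cov E (insert v A) + cov E (B - {v}) \<le> cov E A + cov E B"
    and mC: "\<forall>v\<in>C. cov E (insert v A) + cov E (C - {v}) \<le> cov E A + cov E C"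
    using optimal_move[OF opt] optimal_move[OF optimal_swap(1)[OF opt]] by auto
  note bB = transfer_bounds[OF E(1) E3 fin(1) tri(2) mB W_def]
  note bC = transfer_bounds[OF E(1) E3 fin(2) tri(3) mC W_def]
  obtain X Y where XY: "X \<subseteq> B" "Y \<subseteq> C" "cost W B X \<le> budget W B (card E)"
      "cost W C Y \<le> budget W C (card E)" "cov W (X \<union> Y) \<ge> real (card W) - 2 / 5 * card E"
    using exists_transfer[OF fin(3) W fin(1,2) tri(4) _ big bB(1) bC(1)] E(3) by auto
  have "tripartition V (A \<union> (X \<union> Y)) (B - X) (C - Y)"
    using tri XY(1,2) unfolding tripartition_def by auto
  \<comment> \<open>\<open>A\<close> gains at least |W| - 2m/5 edges and met m - |W| before, where m
    is \<open>card E\<close>.\<close>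
  moreover have "3 / 5 * card E \<le> cov E (A \<union> (X \<union> Y))"
    using cov_Un[OF E(1), of A "X \<union> Y"] XY(5) sum unfolding W_def[symmetric] by argo
  ultimately show ?thesis using bB(2)[OF XY(1,3)] bC(2)[OF XY(2,4)] by blast
qed

theorem theorem3:
  fixes V :: "'a set" and E :: "'a set set" and m :: nat
  assumes "three_uniform_hypergraph V E"
    and "card E = m"
    and "m \<ge> 211"
  shows "\<exists>P. partition_on V P \<and> card P = 3 \<and>
           (\<forall>X\<in>P. real (card {e \<in> E. meets X e}) \<ge> 3 / 5 * real m)"
proof -
  have V: "finite V" and E: "\<forall>e\<in>E. e \<subseteq> V \<and> card e = 3"
    using assms(1) by (auto simp: three_uniform_hypergraph_def)
  then have fE: "finite E" by (meson Pow_iff finite_Pow_iff finite_subset subsetI)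
  have large: "card E \<ge> 210" using assms by simp
  obtain A B C where opt: "optimal V E A B C" using optimal_exists[OF V] by metis
  have "\<exists>A' B' C'. tripartition V A' B' C' \<and> (\<forall>X\<in>{A', B', C'}. 3 / 5 * card E \<le> cov E X)"
  proof (cases "\<forall>X\<in>{A, B, C}. 3 / 5 * card E \<le> cov E X")
    case True
    then show ?thesis using opt unfolding optimal_def by blast
  next
    case False
    then consider "cov E A < 3 / 5 * card E" | "cov E B < 3 / 5 * card E" | "cov E C < 3 / 5 * card E"
      by force
    then show ?thesis
      by cases (blast intro: optimal_repair[OF V fE E large] opt optimal_swap)+
  qed
  then obtain A' B' C' where tri: "tripartition V A' B' C'"
    and ge: "\<forall>X\<in>{A', B', C'}. 3 / 5 * card E \<le> cov E X" by blast
  \<comment> \<open>\<open>tripartition\<close> allows empty parts, \<open>partition_on\<close> does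
    not. A part meeting a positive number of edges is nonempty, and nonempty disjoint parts are
    distinct.\<close>
  have "cov E {} = 0" by (simp add: cov_def meets_def)
  then have "{} \<notin> {A', B', C'}" using ge large by force
  moreover from this have "A' \<noteq> B'" "A' \<noteq> C'" "B' \<noteq> C'"
    using tri by (auto simp: tripartition_def)
  ultimately have "partition_on V {A', B', C'}" "card {A', B', C'} = 3"
    using tri by (auto simp: tripartition_def partition_on_def disjoint_def)
  then show ?thesis
    using ge assms(2) unfolding cov_def by blast
qed

end
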